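(* Let $p$ be an odd prime. If $p>3$, then $$\sum_{k=1}^{p-1}\frac{\binom{2k}{k}}{4^k}H_k\equiv 2-2p+4p^2q_p(2)\pmod{p^3}.$$ Moreover (for every odd prime $p$), $$\sum_{k=0}^{(p-1)/2}\frac{\binom{2k}{k}}{4^k}H_k^{(2)}\equiv -4q_p(2)\pmod p$$ and $$\sum_{k=1}^{(p-1)/2}\frac{\binom{2k}{k}}{k4^k}H_k^{(2)}\equiv\frac{B_{p-3}}{2}\pmod p.$$
   Context: For $n=0,1,2,\ldots$, $H_n:=\sum_{0<k\leqslant n}\frac1k$ and $H_n^{(2)}:=\sum_{0<k\leqslant n}\frac{1}{k^2}$. For an odd prime $p$, $q_p(2):=(2^{p-1}-1)/p$ is the Fermat quotient. $B_0,B_1,B_2,\ldots$ are the Bernoulli numbers ($B_0=1$, $\sum_{k=0}^{n}\binom{n+1}{k}B_k=0$ for $n\geqslant1$). Congruences modulo a power $p^a$ between rational numbers are understood in the ring of rational numbers whose denominators are not divisible by $p$. *)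

theory Defs
  imports "HOL-Analysis.Harmonic_Numbers" "HOL-Computational_Algebra.Primes"
begin

text \<open>
  All quantities are rational numbers, so that congruences can be stated literally in the ring of
  rationals with denominator prime to \<open>p\<close>. The library's \<open>harm\<close> lives in real normed fields and
  cannot be used at type \<open>rat\<close>; \<open>of_rat_harmonic\<close> below relates the two.
\<close>

definition harmonic :: "nat \<Rightarrow> nat \<Rightarrow> rat" where
  "harmonic r n = (\<Sum>k = 1..n. 1 / of_nat k ^ r)"

abbreviation H1 :: "nat \<Rightarrow> rat" where
  "H1 n \<equiv> harmonic 1 n"

abbreviation H2 :: "nat \<Rightarrow> rat" where
  "H2 n \<equiv> harmonic 2 n"

lemma of_rat_harmonic: "(of_rat (H1 n) :: real) = harm n"
  by (simp add: harmonic_def harm_def of_rat_sum of_rat_divide inverse_eq_divide)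

definition fermat_quotient :: "nat \<Rightarrow> nat \<Rightarrow> rat" where
  "fermat_quotient p a = (of_nat a ^ (p - 1) - 1) / of_nat p"

fun bernoulli :: "nat \<Rightarrow> rat" where
  "bernoulli n =
     (if n = 0 then 1
      else - (\<Sum>k<n. of_nat ((n + 1) choose k) * bernoulli k) / of_nat (n + 1))"

declare bernoulli.simps [simp del]

text \<open>The defining recurrence in its usual symmetric form.\<close>

lemma bernoulli_0: "bernoulli 0 = 1"
  by (simp add: bernoulli.simps)

lemma bernoulli_recurrence:
  assumes "n \<ge> 1"
  shows "(\<Sum>k = 0..n. of_nat ((n + 1) choose k) * bernoulli k) = 0"
proof -
  have "of_nat (n + 1) * bernoulli n = - (\<Sum>k<n. of_nat ((n + 1) choose k) * bernoulli k)"
    using assms by (subst bernoulli.simps) (simp add: field_simps del: of_nat_Suc)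
  moreover have "(\<Sum>k = 0..n. of_nat ((n + 1) choose k) * bernoulli k) =
      (\<Sum>k<n. of_nat ((n + 1) choose k) * bernoulli k) + of_nat (n + 1) * bernoulli n"
    by (simp add: atLeast0AtMost lessThan_Suc_atMost [symmetric])
  ultimately show ?thesis
    by simp
qed

text \<open>
  \<open>snd (quotient_of x)\<close> is the denominator of \<open>x\<close> in lowest terms.
\<close>

definition p_integral :: "nat \<Rightarrow> rat set" where
  "p_integral p = {x. \<not> int p dvd snd (quotient_of x)}"

text \<open>Congruence modulo \<open>p ^ a\<close> in the ring \<open>p_integral p\<close>; both sides must lie in the ring.\<close>

definition rat_cong :: "nat \<Rightarrow> nat \<Rightarrow> rat \<Rightarrow> rat \<Rightarrow> bool" where
  "rat_cong p a x y \<longleftrightarrow>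
     x \<in> p_integral p \<and> y \<in> p_integral p \<and> (\<exists>z \<in> p_integral p. x - y = of_nat p ^ a * z)"

end

theory Submission
  imports Defs "HOL-Number_Theory.Residues"
begin

text \<open>
  Write \<open>a\<^sub>k\<close> for the central binomial coefficient divided by \<open>4 ^ k\<close> and \<open>n = (p - 1) / 2\<close>.

  Summation by parts gives \<open>a\<^sub>1 H\<^sub>1 + \<dots> + a\<^sub>m H\<^sub>m = 2 + A (H\<^sub>m - 2)\<close> exactly, with
  \<open>A = 2 (m + 1) a\<^bsub>m+1\<^esub>\<close>. For \<open>m = p - 1\<close>, Wolstenholme's congruence removes \<open>A H\<^sub>m\<close>, and
  \<open>A\<close> is \<open>p / 4 ^ (p - 1)\<close> modulo \<open>p\<^sup>3\<close>.

  The other two sums are treated modulo \<open>p\<close>: \<open>a\<^sub>k\<close> is congruent to \<open>(-1) ^ k (n choose k)\<close>, and the alternating binomial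
  sums of \<open>H\<^sub>k\<^sup>(\<^sup>2\<^sup>)\<close> and \<open>H\<^sub>k\<^sup>(\<^sup>2\<^sup>) / k\<close> are exactly \<open>- H\<^sub>n / n\<close> and \<open>- W\<close>, where
  \<open>W\<close> is the sum of \<open>H\<^sub>j / j\<^sup>2\<close> over \<open>j \<le> n\<close>. The first is \<open>- 4 q\<close> because \<open>H\<^sub>n\<close> is \<open>- 2 q\<close>. For the
  second, the reflection \<open>j \<mapsto> p - j\<close> shows that the sum of \<open>H\<^bsub>j-1\<^esub> / j\<^sup>2\<close> over all \<open>j < p\<close> is
  \<open>2 W - H\<^sub>n\<^sup>(\<^sup>3\<^sup>)\<close>; that sum is \<open>B\<^bsub>p-3\<^esub>\<close> by Faulhaber's formula, and
  \<open>H\<^sub>n\<^sup>(\<^sup>3\<^sup>)\<close> is \<open>- 2 B\<^bsub>p-3\<^esub>\<close> by Voronoi's congruence.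
\<close>

section \<open>Binomial sums of harmonic numbers\<close>

lemma harmonic_0 [simp]: "harmonic r 0 = 0"
  by (simp add: harmonic_def)

lemma harmonic_Suc: "harmonic r (Suc n) = harmonic r n + 1 / of_nat (Suc n) ^ r"
  by (simp add: harmonic_def del: of_nat_Suc)

definition central :: "nat \<Rightarrow> rat" where
  "central k = of_nat ((2 * k) choose k) / 4 ^ k"

lemma central_0 [simp]: "central 0 = 1"
  by (simp add: central_def)

lemma central_Suc: "central (Suc k) = central k * of_nat (2 * k + 1) / of_nat (2 * (k + 1))"
proof -
  have "Suc k * ((2 * Suc k) choose Suc k) = 2 * (2 * k + 1) * ((2 * k) choose k)"
  proof -
    have a: "Suc k * ((2 * Suc k) choose Suc k) = 2 * Suc k * (Suc (2 * k) choose k)"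
      using Suc_times_binomial_eq[of "Suc (2 * k)" k] by simp
    have "(Suc (2 * k) choose k) = (Suc (2 * k) choose Suc k)"
      using binomial_symmetric[of k "Suc (2 * k)"] by simp
    with Suc_times_binomial_eq[of "2 * k" k]
    have "Suc k * (Suc (2 * k) choose k) = (2 * k + 1) * ((2 * k) choose k)" by (simp only: Suc_eq_plus1 mult.commute)
    with a show ?thesis by (simp only: mult.assoc)
  qed
  then have "of_nat (Suc k) * of_nat ((2 * Suc k) choose Suc k) =
      (2 * of_nat (2 * k + 1) * of_nat ((2 * k) choose k) :: rat)"
    by (metis of_nat_mult of_nat_numeral)
  then show ?thesis
    unfolding central_def by (simp add: divide_simps del: binomial_Suc_Suc) (simp add: algebra_simps)
qed

text \<open>The partial sums of \<open>central\<close> from 0 to \<open>n\<close> are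
  \<open>2 * (n + 1) * central (n + 1)\<close>, so summation by parts against \<open>H1\<close>
  closes up. In the induction \<open>H1 n\<close> is rewritten through \<open>H1 (Suc n)\<close>,
  whose extra \<open>1 / of_nat (Suc n)\<close> cancels the factor in front.\<close>

lemma sum_central_harmonic:
  "(\<Sum>k = 1..n. central k * H1 k) = 2 + 2 * of_nat (Suc n) * central (Suc n) * (H1 n - 2)"
proof (induction n)
  case 0
  then show ?case by (simp add: central_Suc)
next
  case (Suc n)
  have e: "central (Suc (Suc n)) * (2 * of_nat (Suc (Suc n))) = central (Suc n) * (2 * of_nat (Suc n) + 1)"
    by (subst central_Suc) (simp add: divide_simps)
  have h: "H1 n = H1 (Suc n) - 1 / of_nat (Suc n)" by (simp add: harmonic_Suc)
  have "(\<Sum>k = 1..Suc n. central k * H1 k) =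
    2 + 2 * of_nat (Suc n) * central (Suc n) * (H1 n - 2) + central (Suc n) * H1 (Suc n)"
    using Suc by simp
  also have "\<dots> = 2 + central (Suc n) * (2 * of_nat (Suc n) + 1) * (H1 (Suc n) - 2)"
    unfolding h by (simp add: divide_simps del: of_nat_Suc) (simp add: algebra_simps del: of_nat_Suc)
  also have "\<dots> = 2 + 2 * of_nat (Suc (Suc n)) * central (Suc (Suc n)) * (H1 (Suc n) - 2)"
    unfolding e[symmetric] by (simp only: mult_ac)
  finally show ?case .
qed

section \<open>Alternating binomial transforms, evaluated exactly\<close>

text \<open>The index starts at 1, so that functions such as \<open>f k / of_nat k\<close> need no
  value at 0.\<close>

definition alt_sum :: "nat \<Rightarrow> (nat \<Rightarrow> rat) \<Rightarrow> rat" where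
  "alt_sum n f = (\<Sum>k = 1..n. (-1) ^ k * of_nat (n choose k) * f k)"

text \<open>The absorption rule \<open>Suc k * (Suc n choose Suc k) = Suc n * (n choose k)\<close>
  moves a division by the index into \<open>f\<close>.\<close>

lemma alt_sum_Suc_shift:
  "alt_sum (Suc n) f = - of_nat (Suc n) * (\<Sum>k\<le>n. (-1) ^ k * of_nat (n choose k) * (f (Suc k) / of_nat (Suc k)))"
proof -
  have b: "of_nat (Suc n choose Suc k) = (of_nat (Suc n) * of_nat (n choose k) / of_nat (Suc k) :: rat)" for k
  proof -
    have "of_nat (Suc n choose Suc k) * of_nat (Suc k) = (of_nat (Suc n) * of_nat (n choose k) :: rat)"
      unfolding of_nat_mult[symmetric] using Suc_times_binomial_eq[of n k] by (simp only: )
    then show ?thesis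
      by (simp add: eq_divide_eq del: of_nat_Suc binomial_Suc_Suc)
  qed
  have "alt_sum (Suc n) f = (\<Sum>k = 0..n. (-1) ^ Suc k * of_nat (Suc n choose Suc k) * f (Suc k))"
    unfolding alt_sum_def by (simp only: One_nat_def sum.shift_bounds_cl_Suc_ivl)
  also have "\<dots> = - of_nat (Suc n) * (\<Sum>k = 0..n. (-1) ^ k * of_nat (n choose k) * (f (Suc k) / of_nat (Suc k)))"
    unfolding b sum_distrib_left by (intro sum.cong) (auto simp: mult_ac simp del: of_nat_Suc binomial_Suc_Suc)
  finally show ?thesis by (simp add: atLeast0AtMost)
qed

lemma alt_sum_pascal:
  "alt_sum (Suc n) f = alt_sum n f - (\<Sum>k\<le>n. (-1) ^ k * of_nat (n choose k) * f (Suc k))"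
proof -
  have "alt_sum (Suc n) f = (\<Sum>k\<le>n. (-1) ^ Suc k * of_nat (Suc n choose Suc k) * f (Suc k))"
    unfolding alt_sum_def by (simp only: One_nat_def sum.shift_bounds_cl_Suc_ivl atLeast0AtMost)
  also have "\<dots> = (\<Sum>k\<le>n. (-1) ^ Suc k * of_nat (n choose Suc k) * f (Suc k)) -
      (\<Sum>k\<le>n. (-1) ^ k * of_nat (n choose k) * f (Suc k))"
    unfolding sum_subtractf[symmetric] by (intro sum.cong refl) (simp add: algebra_simps)
  also have "(\<Sum>k\<le>n. (-1) ^ Suc k * of_nat (n choose Suc k) * f (Suc k)) =
     (\<Sum>k = 1..Suc n. (-1) ^ k * of_nat (n choose k) * f k)"
    by (simp only: One_nat_def sum.shift_bounds_cl_Suc_ivl atLeast0AtMost)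
  also have "\<dots> = alt_sum n f" by (simp add: alt_sum_def)
  finally show ?thesis .
qed

text \<open>Pascal's rule for \<open>f k / of_nat k\<close> leaves exactly the shifted sum that
  absorption identifies with the transform of \<open>f\<close>. This is the induction step of both
  evaluations below that involve a division by \<open>k\<close>.\<close>

lemma alt_sum_divide_Suc:
  "alt_sum (Suc n) (\<lambda>k. f k / of_nat k) =
   alt_sum n (\<lambda>k. f k / of_nat k) + alt_sum (Suc n) f / of_nat (Suc n)"
  using alt_sum_pascal[of n "\<lambda>k. f k / of_nat k"] alt_sum_Suc_shift[of n f]
  by (simp add: divide_simps del: of_nat_Suc)

text \<open>By Pascal's rule \<open>alt_sum (Suc n) f\<close> is minus the alternating sum of the
  differences \<open>f (Suc k) - f k\<close>, and absorption then accounts for the factor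
  \<open>Suc n\<close>. The assumption on \<open>f 0\<close> supplies the term at 0 that
  \<open>alt_sum\<close> omits.\<close>

lemma alt_sum_telescope:
  assumes "f 0 = 0"
  shows "of_nat (Suc n) * alt_sum (Suc n) f = alt_sum (Suc n) (\<lambda>k. of_nat k * (f k - f (k - 1)))"
proof -
  have "alt_sum n f = (\<Sum>k\<le>n. (-1) ^ k * of_nat (n choose k) * f k)"
    unfolding alt_sum_def using assms
    by (simp add: sum.atLeast_Suc_atMost atLeast0AtMost[symmetric])
  then have "alt_sum (Suc n) f = - (\<Sum>k\<le>n. (-1) ^ k * of_nat (n choose k) * (f (Suc k) - f k))"
    by (simp add: alt_sum_pascal right_diff_distrib sum_subtractf)
  then show ?thesis
    by (simp add: alt_sum_Suc_shift del: of_nat_Suc)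
qed

text \<open>The full alternating row sum is 0, and its term at \<open>k = 0\<close> is 1.\<close>

lemma alt_sum_one: "alt_sum (Suc n) (\<lambda>_. 1) = -1"
proof -
  have "0 = (\<Sum>k = 0..Suc n. (-1) ^ k * of_nat (Suc n choose k) :: rat)"
    using choose_alternating_sum[of "Suc n", where 'a = rat] by (simp only: atLeast0AtMost zero_less_Suc)
  also have "\<dots> = 1 + alt_sum (Suc n) (\<lambda>_. 1)"
    unfolding alt_sum_def by (subst sum.atLeast_Suc_atMost) (simp_all del: binomial_Suc_Suc)
  finally show ?thesis by linarith
qed

lemma alt_sum_inverse: "alt_sum n (\<lambda>k. 1 / of_nat k) = - H1 n"
proof (induction n)
  case 0
  then show ?case by (simp add: alt_sum_def)
next
  case (Suc n)
  then show ?case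
    using alt_sum_divide_Suc[of n "\<lambda>_. 1"] by (simp add: alt_sum_one harmonic_Suc)
qed

text \<open>Telescoping applies because \<open>k * (H2 k - H2 (k - 1))\<close> is
  \<open>1 / k\<close>. The factor \<open>n\<close> stays on the left: modulo
  \<open>p = 2 * n + 1\<close> it acts as \<open>- 1 / 2\<close>.\<close>

lemma alt_sum_harmonic2: "of_nat n * alt_sum n H2 = - H1 n"
proof (cases n)
  case 0
  then show ?thesis by simp
next
  case (Suc m)
  have "of_nat n * alt_sum n H2 = alt_sum n (\<lambda>k. of_nat k * (H2 k - H2 (k - 1)))"
    unfolding Suc by (rule alt_sum_telescope) simp
  also have "\<dots> = alt_sum n (\<lambda>k. 1 / of_nat k)"
    unfolding alt_sum_def
  proof (intro sum.cong refl)
    fix k assume "k \<in> {1..n}"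
    then obtain j where "k = Suc j" by (cases k) auto
    then show "(-1) ^ k * of_nat (n choose k) * (of_nat k * (H2 k - H2 (k - 1))) =
        (-1) ^ k * of_nat (n choose k) * (1 / rat_of_nat k)"
      by (simp add: harmonic_Suc power2_eq_square del: of_nat_Suc)
  qed
  finally show ?thesis by (simp add: alt_sum_inverse)
qed

lemma alt_sum_harmonic2_divide:
  "alt_sum n (\<lambda>k. H2 k / of_nat k) = - (\<Sum>j = 1..n. H1 j / of_nat j ^ 2)"
proof (induction n)
  case 0
  then show ?case by (simp add: alt_sum_def)
next
  case (Suc n)
  have "alt_sum (Suc n) H2 / of_nat (Suc n) = - (H1 (Suc n) / of_nat (Suc n) ^ 2)"
    using alt_sum_harmonic2[of "Suc n"]
    by (simp add: divide_simps power2_eq_square del: of_nat_Suc) (simp add: mult_ac del: of_nat_Suc)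
  with Suc show ?case
    using alt_sum_divide_Suc[of n H2] by (simp del: of_nat_Suc)
qed

section \<open>Faulhaber's formula for sums of powers\<close>

text \<open>Induction on \<open>m\<close>. The increment of the right side is expanded in powers of
  \<open>m\<close>; the coefficient of \<open>m ^ s\<close> contains the Bernoulli recurrence at
  index \<open>k - s\<close>, so only \<open>s = k\<close> survives.\<close>

lemma faulhaber:
  "of_nat (Suc k) * (\<Sum>i<m. of_nat i ^ k) =
   (\<Sum>r\<le>k. of_nat (Suc k choose r) * bernoulli r * of_nat m ^ (Suc k - r))"
proof (induction m)
  case 0
  have "(\<Sum>r\<le>k. of_nat (Suc k choose r) * bernoulli r * 0 ^ (Suc k - r)) = 0"
    by (intro sum.neutral) (auto simp: power_0_left)
  then show ?case by simp
next
  case (Suc m)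
  \<comment> \<open>The top term of the binomial expansion is split off; it reproduces the formula
    for \<open>m\<close>.\<close>
  have step: "(of_nat (Suc m) :: rat) ^ (Suc k - r) = of_nat m ^ (Suc k - r) +
      (\<Sum>s\<le>k - r. of_nat (Suc k - r choose s) * of_nat m ^ s)" if "r \<le> k" for r
  proof -
    have "(of_nat (Suc m) :: rat) ^ (Suc k - r) = (of_nat m + 1) ^ Suc (k - r)"
      using that by (simp add: Suc_diff_le add.commute)
    also have "\<dots> = (\<Sum>s\<le>Suc (k - r). of_nat (Suc (k - r) choose s) * of_nat m ^ s)"
      by (simp only: binomial_ring power_one mult_1_right)
    finally show ?thesis
      using that by (simp add: Suc_diff_le)
  qed
  have "(\<Sum>r\<le>k. of_nat (Suc k choose r) * bernoulli r * of_nat (Suc m) ^ (Suc k - r)) =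
      (\<Sum>r\<le>k. of_nat (Suc k choose r) * bernoulli r * of_nat m ^ (Suc k - r)) +
      (\<Sum>r\<le>k. \<Sum>s\<le>k - r. of_nat (Suc k choose r) * bernoulli r * (of_nat (Suc k - r choose s) * of_nat m ^ s))"
    (is "_ = _ + ?D")
    unfolding sum.distrib[symmetric] sum_distrib_left[symmetric]
    by (intro sum.cong refl) (simp only: atMost_iff step ring_distribs)
  also have "?D = of_nat (Suc k) * of_nat m ^ k"
  proof -
    have "?D = (\<Sum>s\<le>k. \<Sum>r\<le>k - s. of_nat (Suc k choose r) * bernoulli r * (of_nat (Suc k - r choose s) * of_nat m ^ s))"
    proof -
      have "?D = (\<Sum>r\<le>k. \<Sum>s | s \<in> {..k} \<and> r + s \<le> k. of_nat (Suc k choose r) * bernoulli r * (of_nat (Suc k - r choose s) * of_nat m ^ s))"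
        by (intro sum.cong) auto
      also have "\<dots> = (\<Sum>s\<le>k. \<Sum>r | r \<in> {..k} \<and> r + s \<le> k. of_nat (Suc k choose r) * bernoulli r * (of_nat (Suc k - r choose s) * of_nat m ^ s))"
        by (rule sum.swap_restrict) auto
      also have "\<dots> = (\<Sum>s\<le>k. \<Sum>r\<le>k - s. of_nat (Suc k choose r) * bernoulli r * (of_nat (Suc k - r choose s) * of_nat m ^ s))"
        by (intro sum.cong) auto
      finally show ?thesis .
    qed
    also have "\<dots> = (\<Sum>s\<le>k. of_nat (Suc k choose s) * of_nat m ^ s * (\<Sum>r\<le>k - s. of_nat ((k - s + 1) choose r) * bernoulli r))"
      unfolding sum_distrib_left
    proof (intro sum.cong refl)
      fix s r assume sr: "s \<in> {..k}" "r \<in> {..k - s}"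
      \<comment> \<open>Both sides count the ways to choose disjoint sets of sizes \<open>r\<close>
        and \<open>s\<close> from \<open>Suc k\<close> elements.\<close>
      have "(Suc k choose r) * (Suc k - r choose s) = (Suc k choose s) * (k - s + 1 choose r)"
      proof -
        have "(Suc k choose (r + s)) * (r + s choose r) = (Suc k choose r) * (Suc k - r choose s)"
          using sr choose_mult[of r "r + s" "Suc k"] by simp
        moreover have "(Suc k choose (r + s)) * (r + s choose s) = (Suc k choose s) * (Suc k - s choose r)"
          using sr choose_mult[of s "r + s" "Suc k"] by simp
        moreover have "(r + s choose r) = (r + s choose s)"
          using binomial_symmetric[of r "r + s"] by simp
        ultimately show ?thesis using sr by (simp add: Suc_diff_le)
      qed
      then have "(of_nat (Suc k choose r) * of_nat (Suc k - r choose s) :: rat) =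
          of_nat (Suc k choose s) * of_nat (k - s + 1 choose r)"
        by (metis of_nat_mult)
      then show "of_nat (Suc k choose r) * bernoulli r * (of_nat (Suc k - r choose s) * of_nat m ^ s) =
          of_nat (Suc k choose s) * of_nat m ^ s * (of_nat (k - s + 1 choose r) * bernoulli r)"
        by (metis (no_types, lifting) mult.assoc mult.commute)
    qed
    also have "\<dots> = (\<Sum>s\<le>k. if s = k then of_nat (Suc k choose s) * of_nat m ^ s else 0)"
    proof (intro sum.cong refl)
      fix s assume "s \<in> {..k}"
      then show "of_nat (Suc k choose s) * of_nat m ^ s * (\<Sum>r\<le>k - s. of_nat ((k - s + 1) choose r) * bernoulli r) =
          (if s = k then of_nat (Suc k choose s) * of_nat m ^ s else 0)"
        using bernoulli_recurrence[of "k - s"] by (auto simp: bernoulli_0 atLeast0AtMost)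
    qed
    also have "\<dots> = of_nat (Suc k) * of_nat m ^ k" by simp
    finally show ?thesis .
  qed
  finally show ?case using Suc by (simp add: algebra_simps)
qed

section \<open>Congruences between \<open>p\<close>-integral rationals\<close>

text \<open>The denominator in lowest terms divides every other denominator, so any representation
  with denominator prime to \<open>p\<close> will do.\<close>

lemma p_integral_fraction:
  assumes "\<not> int p dvd b"
  shows "of_int a / of_int b \<in> p_integral p"
proof -
  obtain c d where cd: "quotient_of (of_int a / of_int b) = (c, d)" by (cases "quotient_of (of_int a / of_int b)")
  have "of_int a / of_int b = (of_int c / of_int d :: rat)" "d > 0" "coprime c d"
    using quotient_of_div[OF cd] quotient_of_denom_pos[OF cd] quotient_of_coprime[OF cd] by auto
  moreover have "b \<noteq> 0" using assms by auto
  ultimately have "(of_int (a * d) :: rat) = of_int (c * b)"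
    by (simp add: divide_simps split: if_splits)
  then have "d dvd c * b" by (metis dvd_triv_right of_int_eq_iff)
  with \<open>coprime c d\<close> have "d dvd b" by (simp add: coprime_dvd_mult_right_iff coprime_commute)
  with assms have "\<not> int p dvd d" by (meson dvd_trans)
  then show ?thesis by (simp add: p_integral_def cd)
qed

lemma p_integralE:
  assumes "x \<in> p_integral p"
  obtains a b where "x = of_int a / of_int b" "\<not> int p dvd b" "b \<noteq> 0"
proof -
  obtain a b where ab: "quotient_of x = (a, b)" by (cases "quotient_of x")
  then have "\<not> int p dvd b" using assms by (simp add: p_integral_def)
  moreover from this have "b \<noteq> 0" by auto
  ultimately show thesis using that quotient_of_div[OF ab] by blast
qed

section \<open>The ring of \<open>p\<close>-integral rationals\<close>

locale prime_modulus =
  fixes p :: nat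
  assumes p: "prime p"
begin

lemma p_integral_of_int [simp]: "of_int a \<in> p_integral p"
  using p_integral_fraction[of p 1 a] prime_gt_1_nat[OF p] by simp

lemma p_integral_of_nat [simp]: "of_nat a \<in> p_integral p"
  using p_integral_of_int[of "int a"] by simp

lemma p_integral_0 [simp]: "0 \<in> p_integral p"
  and p_integral_1 [simp]: "1 \<in> p_integral p"
  and p_integral_numeral [simp]: "numeral m \<in> p_integral p"
  using p_integral_of_nat[of 0] p_integral_of_nat[of 1] p_integral_of_nat[of "numeral m"] by simp_all

text \<open>Primality enters here: a product of denominators not divisible by \<open>p\<close> is
  not divisible by \<open>p\<close>.\<close>

lemma p_integral_mult [simp]:
  assumes "x \<in> p_integral p" "y \<in> p_integral p"
  shows "x * y \<in> p_integral p"
proof -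
  obtain a b c d where "x = of_int a / of_int b" "\<not> int p dvd b" "y = of_int c / of_int d" "\<not> int p dvd d"
    using assms by (metis p_integralE)
  then show ?thesis
    using p_integral_fraction[of p "b * d" "a * c"] p by (simp add: prime_dvd_mult_iff)
qed

lemma p_integral_add [simp]:
  assumes "x \<in> p_integral p" "y \<in> p_integral p"
  shows "x + y \<in> p_integral p"
proof -
  obtain a b c d where ab: "x = of_int a / of_int b" "\<not> int p dvd b" "b \<noteq> 0"
    and cd: "y = of_int c / of_int d" "\<not> int p dvd d" "d \<noteq> 0"
    using assms by (metis p_integralE)
  have "x + y = of_int (a * d + c * b) / of_int (b * d)"
    unfolding ab(1) cd(1) using ab(3) cd(3) by (simp add: add_frac_eq)
  then show ?thesis
    using p_integral_fraction[of p "b * d" "a * d + c * b"] p ab cd by (simp add: prime_dvd_mult_iff)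
qed

lemma p_integral_uminus [simp]: "x \<in> p_integral p \<Longrightarrow> - x \<in> p_integral p"
  using p_integral_mult[of "-1" x] p_integral_of_int[of "-1"] by simp

lemma p_integral_diff [simp]: "x \<in> p_integral p \<Longrightarrow> y \<in> p_integral p \<Longrightarrow> x - y \<in> p_integral p"
  using p_integral_add[of x "- y"] by simp

lemma p_integral_power [simp]: "x \<in> p_integral p \<Longrightarrow> x ^ k \<in> p_integral p"
  by (induction k) simp_all

lemma p_integral_sum [simp]: "(\<And>i. i \<in> I \<Longrightarrow> f i \<in> p_integral p) \<Longrightarrow> sum f I \<in> p_integral p"
  by (induction I rule: infinite_finite_induct) simp_all

lemma p_integral_inverse [simp]: "\<not> p dvd k \<Longrightarrow> 1 / of_nat k \<in> p_integral p"
  using p_integral_fraction[of p "int k" 1] by simp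

lemma p_integral_divide_power [simp]:
  assumes "\<not> p dvd k" "x \<in> p_integral p"
  shows "x / of_nat k ^ r \<in> p_integral p"
  using p_integral_mult[OF assms(2) p_integral_power[OF p_integral_inverse[OF assms(1)], of r]]
  by (simp add: power_divide)

lemma p_integral_divide [simp]:
  "\<not> p dvd k \<Longrightarrow> x \<in> p_integral p \<Longrightarrow> x / of_nat k \<in> p_integral p"
  using p_integral_divide_power[of k x 1] by simp

lemma not_dvd_of_less: "0 < k \<Longrightarrow> k < p \<Longrightarrow> \<not> p dvd k"
  by (simp add: nat_dvd_not_less)

lemma p_integral_harmonic [simp]: "n < p \<Longrightarrow> harmonic r n \<in> p_integral p"
  unfolding harmonic_def by (intro p_integral_sum p_integral_divide_power) (simp_all add: not_dvd_of_less)

section \<open>Calculus of congruences modulo powers of \<open>p\<close>\<close>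

lemma rat_congI: "x \<in> p_integral p \<Longrightarrow> y \<in> p_integral p \<Longrightarrow> z \<in> p_integral p \<Longrightarrow>
    x - y = of_nat p ^ a * z \<Longrightarrow> rat_cong p a x y"
  by (auto simp: rat_cong_def)

lemma rat_cong_refl [simp]: "x \<in> p_integral p \<Longrightarrow> rat_cong p a x x"
  by (rule rat_congI[of _ _ 0]) simp_all

lemma rat_cong_sym: "rat_cong p a x y \<Longrightarrow> rat_cong p a y x"
proof -
  assume a: "rat_cong p a x y"
  then obtain z where "z \<in> p_integral p" "x - y = of_nat p ^ a * z" by (auto simp: rat_cong_def)
  then show ?thesis
    using a by (intro rat_congI[of _ _ "- z"]) (auto simp: rat_cong_def algebra_simps)
qed

lemma rat_cong_add:
  assumes "rat_cong p a x y" "rat_cong p a u v"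
  shows "rat_cong p a (x + u) (y + v)"
proof -
  obtain z w where "z \<in> p_integral p" "w \<in> p_integral p" "x - y = of_nat p ^ a * z" "u - v = of_nat p ^ a * w"
    using assms by (auto simp: rat_cong_def)
  then show ?thesis
    using assms by (intro rat_congI[of _ _ "z + w"]) (auto simp: rat_cong_def algebra_simps)
qed

lemma rat_cong_trans [trans]:
  assumes "rat_cong p a x y" "rat_cong p a y z"
  shows "rat_cong p a x z"
proof -
  obtain u v where "u \<in> p_integral p" "v \<in> p_integral p" "x - y = of_nat p ^ a * u" "y - z = of_nat p ^ a * v"
    using assms by (auto simp: rat_cong_def)
  then show ?thesis
    using assms by (intro rat_congI[of _ _ "u + v"]) (auto simp: rat_cong_def algebra_simps)
qed

lemma rat_cong_mult:
  assumes "rat_cong p a x y" "rat_cong p a u v"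
  shows "rat_cong p a (x * u) (y * v)"
proof -
  obtain z w where zw: "z \<in> p_integral p" "w \<in> p_integral p" "x - y = of_nat p ^ a * z" "u - v = of_nat p ^ a * w"
    using assms by (auto simp: rat_cong_def)
  have "x * u - y * v = (x - y) * u + y * (u - v)" by (simp add: algebra_simps)
  also have "\<dots> = of_nat p ^ a * (z * u + y * w)" by (simp only: zw) (simp add: algebra_simps)
  finally show ?thesis
    using assms zw by (intro rat_congI[of _ _ "z * u + y * w"]) (auto simp: rat_cong_def)
qed

lemma rat_cong_cmult: "c \<in> p_integral p \<Longrightarrow> rat_cong p a x y \<Longrightarrow> rat_cong p a (c * x) (c * y)"
  by (intro rat_cong_mult) simp_all

lemma rat_cong_uminus: "rat_cong p a x y \<Longrightarrow> rat_cong p a (- x) (- y)"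
  using rat_cong_cmult[of "-1" a x y] by simp

lemma rat_cong_diff: "rat_cong p a x y \<Longrightarrow> rat_cong p a u v \<Longrightarrow> rat_cong p a (x - u) (y - v)"
  using rat_cong_add[of a x y "- u" "- v"] rat_cong_uminus[of a u v] by simp

lemma rat_cong_power: "rat_cong p a x y \<Longrightarrow> rat_cong p a (x ^ k) (y ^ k)"
  by (induction k) (simp_all add: rat_cong_mult)

lemma rat_cong_sum: "(\<And>i. i \<in> I \<Longrightarrow> rat_cong p a (f i) (g i)) \<Longrightarrow> rat_cong p a (sum f I) (sum g I)"
  by (induction I rule: infinite_finite_induct) (simp_all add: rat_cong_add)

lemma rat_cong_sum_0: "(\<And>i. i \<in> I \<Longrightarrow> rat_cong p a (f i) 0) \<Longrightarrow> rat_cong p a (sum f I) 0"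
  using rat_cong_sum[of I a f "\<lambda>_. 0"] by simp

lemma rat_cong_lift: "rat_cong p a x y \<Longrightarrow> rat_cong p (b + a) (of_nat p ^ b * x) (of_nat p ^ b * y)"
  unfolding rat_cong_def by (auto simp: power_add right_diff_distrib[symmetric])

text \<open>Cancelling \<open>p\<close> costs one power of the modulus. Integrality of
  \<open>x\<close> and \<open>y\<close> is assumed, since that of \<open>p * x\<close> and
  \<open>p * y\<close> does not imply it.\<close>

lemma rat_cong_cancel_p:
  assumes "rat_cong p (Suc a) (of_nat p * x) (of_nat p * y)" "x \<in> p_integral p" "y \<in> p_integral p"
  shows "rat_cong p a x y"
proof -
  obtain z where z: "z \<in> p_integral p" "of_nat p * x - of_nat p * y = of_nat p ^ Suc a * z"
    using assms by (auto simp: rat_cong_def)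
  then have "of_nat p * (x - y) = of_nat p * (of_nat p ^ a * z)" by (simp add: algebra_simps)
  then show ?thesis using z assms p by (intro rat_congI[of _ _ z]) auto
qed

lemma rat_cong_weaken: "rat_cong p (b + a) x y \<Longrightarrow> rat_cong p a x y"
proof -
  assume a: "rat_cong p (b + a) x y"
  then obtain z where "z \<in> p_integral p" "x - y = of_nat p ^ (b + a) * z" by (auto simp: rat_cong_def)
  then show ?thesis
    using a by (intro rat_congI[of _ _ "of_nat p ^ b * z"]) (auto simp: rat_cong_def power_add mult_ac)
qed

lemma rat_cong_divide:
  "rat_cong p a x y \<Longrightarrow> \<not> p dvd k \<Longrightarrow> rat_cong p a (x / of_nat k) (y / of_nat k)"
  using rat_cong_cmult[OF p_integral_inverse, of k a x y] by simp

lemma rat_cong_cancel: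
  assumes "rat_cong p a (of_nat k * x) (of_nat k * y)" "\<not> p dvd k"
  shows "rat_cong p a x y"
proof -
  have "k \<noteq> 0" using assms(2) by (metis dvd_0_right)
  then show ?thesis using rat_cong_divide[OF assms] by simp
qed

lemma rat_cong_p_0: "x \<in> p_integral p \<Longrightarrow> rat_cong p 1 (of_nat p * x) 0"
  by (rule rat_congI[of _ _ x]) simp_all

lemma rat_cong_of_nat_complement: "k \<le> p \<Longrightarrow> rat_cong p 1 (of_nat (p - k)) (- of_nat k)"
  by (rule rat_congI[of _ _ 1]) (simp_all add: of_nat_diff)

lemma rat_cong_inverse:
  assumes "rat_cong p a (of_nat j) (c * of_nat k)" "\<not> p dvd j" "\<not> p dvd k" "c = 1 \<or> c = -1"
  shows "rat_cong p a (1 / of_nat j) (c / of_nat k)"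
proof -
  have nz: "j \<noteq> 0" "k \<noteq> 0" using assms by (metis dvd_0_right)+
  \<comment> \<open>The hypothesis is multiplied by \<open>c / (j * k)\<close>; since
    \<open>c * c = 1\<close>, the two sides become \<open>1 / j\<close> and
    \<open>c / k\<close>.\<close>
  have "rat_cong p a (c * of_nat k * (c / (of_nat j * of_nat k))) (of_nat j * (c / (of_nat j * of_nat k)))"
    by (rule rat_cong_sym, rule rat_cong_mult[OF assms(1)])
      (use assms(2-) p_integral_inverse[of "j * k"] p in \<open>auto simp: prime_dvd_mult_iff\<close>)
  with nz assms(4) show ?thesis by auto
qed

lemma rat_cong_inverse_complement:
  assumes "0 < k" "k < p"
  shows "rat_cong p 1 (1 / of_nat (p - k)) (- 1 / of_nat k)"
  using assms rat_cong_of_nat_complement[of k] not_dvd_of_less[of k] not_dvd_of_less[of "p - k"]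
  by (intro rat_cong_inverse) simp_all

lemma rat_cong_inverse_power_complement:
  assumes "0 < k" "k < p"
  shows "rat_cong p 1 (1 / of_nat (p - k) ^ r) ((- 1) ^ r / of_nat k ^ r)"
  using rat_cong_power[OF rat_cong_inverse_complement[OF assms], of r] by (simp only: power_divide power_one)

section \<open>Fermat's little theorem and integrality of Bernoulli numbers\<close>

lemma fermat_rat:
  assumes "\<not> p dvd k"
  shows "rat_cong p 1 (of_nat k ^ (p - 1)) 1"
proof -
  have "[k ^ (p - 1) = 1] (mod p)" using fermat_theorem[OF p assms] .
  then have "[int (k ^ (p - 1)) = int 1] (mod int p)" by (simp only: cong_int_iff)
  then obtain z where "int (k ^ (p - 1)) - 1 = int p * z"
    by (auto simp: cong_iff_dvd_diff)
  then have "of_int (int (k ^ (p - 1)) - 1) = (of_int (int p * z) :: rat)" by simp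
  then show ?thesis by (intro rat_congI[of _ _ "of_int z"]) simp_all
qed

lemma inverse_power_cong:
  assumes "\<not> p dvd k" "r \<le> p - 1"
  shows "rat_cong p 1 (1 / of_nat k ^ r) (of_nat k ^ (p - 1 - r))"
proof -
  have "k \<noteq> 0" using assms by (metis dvd_0_right)
  then have "of_nat k ^ (p - 1) / of_nat k ^ r = (of_nat k ^ (p - 1 - r) :: rat)"
    using assms(2) by (subst power_diff[of _ r "p - 1"]) simp_all
  with rat_cong_mult[OF fermat_rat[OF assms(1)] rat_cong_refl[of "1 / of_nat k ^ r" 1]] assms(1)
  show ?thesis by (simp add: rat_cong_sym)
qed

text \<open>The recurrence divides only by \<open>r + 1\<close>, which is positive and less than
  \<open>p\<close>.\<close>

lemma p_integral_bernoulli: "r + 2 \<le> p \<Longrightarrow> bernoulli r \<in> p_integral p"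
proof (induction r rule: less_induct)
  case (less r)
  show ?case
  proof (cases "r = 0")
    case False
    have "\<not> p dvd (r + 1)" using less.prems by (intro not_dvd_of_less) auto
    then have "- (\<Sum>k<r. of_nat ((r + 1) choose k) * bernoulli k) / of_nat (r + 1) \<in> p_integral p"
      using less by (intro p_integral_divide p_integral_uminus p_integral_sum p_integral_mult) auto
    with False show ?thesis by (subst bernoulli.simps) simp
  qed (simp add: bernoulli_0)
qed

end

section \<open>Sums modulo a prime\<close>

text \<open>The subtraction is taken in \<open>rat\<close>, so no bound on \<open>k\<close> is
  required: for \<open>k > m\<close> both binomials vanish.\<close>

lemma binomial_Suc_rat:
  "(of_nat (m choose Suc k) :: rat) = of_nat (m choose k) * (of_nat m - of_nat k) / of_nat (Suc k)"
proof -
  have "Suc k * (m choose Suc k) = (m - k) * (m choose k)"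
    by (simp only: binomial_absorption binomial_absorb_comp)
  then have "of_nat (Suc k) * (of_nat (m choose Suc k) :: rat) = of_nat (m - k) * of_nat (m choose k)"
    by (simp only: of_nat_mult[symmetric])
  also have "\<dots> = (of_nat m - of_nat k) * of_nat (m choose k)"
    by (cases "k \<le> m") (auto simp: of_nat_diff)
  finally show ?thesis
    by (simp add: eq_divide_eq mult_ac del: of_nat_Suc)
qed

text \<open>Iterated, this writes \<open>q + m choose m\<close> as the product of
  \<open>1 + q / j\<close> over \<open>j\<close> from 1 to \<open>m\<close>.\<close>

lemma binomial_add_Suc_rat:
  "(of_nat (q + Suc m choose Suc m) :: rat) = of_nat (q + m choose m) * (1 + of_nat q / of_nat (Suc m))"
proof -
  have "Suc (q + m) * (q + m choose m) = (q + Suc m choose Suc m) * Suc m"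
    using Suc_times_binomial_eq[of "q + m" m] by simp
  then have "of_nat (Suc (q + m)) * of_nat (q + m choose m) = (of_nat (q + Suc m choose Suc m) * of_nat (Suc m) :: rat)"
    by (simp only: of_nat_mult[symmetric])
  then have "of_nat (q + Suc m choose Suc m) = (of_nat (q + m choose m) * of_nat (Suc (q + m)) / of_nat (Suc m) :: rat)"
    by (simp add: eq_divide_eq mult_ac del: of_nat_Suc binomial_Suc_Suc)
  moreover have "1 + of_nat q / of_nat (Suc m) = (of_nat (Suc (q + m)) / of_nat (Suc m) :: rat)"
    by (simp add: divide_simps)
  ultimately show ?thesis by (simp only: times_divide_eq_right)
qed

text \<open>The alternating sum is \<open>H1 (2 * n)\<close> minus twice its even-indexed terms, and
  these double to \<open>H1 n\<close>.\<close>

lemma alternating_harmonic: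
  "(\<Sum>k = 1..2 * n. (-1) ^ (k - 1) / of_nat k) = H1 (2 * n) - H1 n"
proof (induction n)
  case (Suc n)
  have "(-1 :: rat) ^ (2 * n) = 1" by simp
  then show ?case using Suc
    by (simp add: harmonic_Suc divide_simps) (simp add: algebra_simps)
qed simp

lemma sum_odd_even:
  fixes f :: "nat \<Rightarrow> 'a :: comm_monoid_add"
  shows "(\<Sum>j = 1..2 * n. f j) = (\<Sum>i = 1..n. f (2 * i) + f (2 * i - 1))"
  by (induction n) (simp_all add: add_ac)

section \<open>Odd primes and the reflection of indices\<close>

locale odd_prime_modulus = prime_modulus +
  assumes odd_p: "odd p"
begin

definition half :: nat where "half = (p - 1) div 2"

lemma p_eq: "p = Suc (2 * half)"
  using odd_p by (auto simp: half_def elim!: oddE)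

lemma p_minus_1: "p - 1 = 2 * half"
  using p_eq by simp

lemma p_ge_3: "3 \<le> p"
  using prime_gt_1_nat[OF p] odd_p by (cases "p = 2") auto

lemma two_half_less: "2 * half < p"
  using p_eq by linarith

lemma half_less: "half < p"
  using two_half_less by simp

lemma not_dvd_2: "\<not> p dvd 2"
  using p_ge_3 by (intro not_dvd_of_less) auto

lemma sum_complement:
  fixes f :: "nat \<Rightarrow> rat"
  shows "(\<Sum>j = 1..p - 1. f j) = (\<Sum>j = 1..p - 1. f (p - j))"
  using p_ge_3 by (subst sum.atLeastAtMost_rev) simp

lemma sum_fold:
  fixes f :: "nat \<Rightarrow> rat"
  shows "(\<Sum>j = 1..p - 1. f j) = (\<Sum>j = 1..half. f j + f (p - j))"
proof -
  have "(\<Sum>j = 1..p - 1. f j) = (\<Sum>j = 1..half. f j) + (\<Sum>j = Suc half..2 * half. f j)"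
    unfolding p_minus_1 using sum.ub_add_nat[of 1 half f half] by (simp add: mult_2)
  also have "(\<Sum>j = Suc half..2 * half. f j) = (\<Sum>j = 1..half. f (p - j))"
    using p_eq by (intro sum.reindex_bij_witness[of _ "\<lambda>j. p - j" "\<lambda>j. p - j"]) auto
  finally show ?thesis by (simp add: sum.distrib)
qed

lemma sum_lessThan_power:
  "0 < e \<Longrightarrow> (\<Sum>i<p. (of_nat i :: rat) ^ e) = (\<Sum>i = 1..p - 1. of_nat i ^ e)"
  using p_ge_3 by (intro sum.mono_neutral_right) (auto simp: not_le)

section \<open>Power sums and Wolstenholme's congruence\<close>

text \<open>In Faulhaber's formula at \<open>m = p\<close> the term \<open>r\<close> carries
  \<open>p ^ (e + 1 - r)\<close>, so modulo the square of \<open>p\<close> only \<open>r = e\<close>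
  remains. Its factor \<open>e + 1\<close> is less than \<open>p\<close> and cancels.\<close>

lemma power_sum_cong:
  assumes "0 < e" "e + 2 \<le> p"
  shows "rat_cong p 2 (\<Sum>i = 1..p - 1. of_nat i ^ e) (of_nat p * bernoulli e)"
proof -
  have "rat_cong p 2 (\<Sum>r<e. of_nat (Suc e choose r) * bernoulli r * of_nat p ^ (Suc e - r)) 0"
  proof (rule rat_cong_sum_0)
    fix r assume "r \<in> {..<e}"
    then obtain d where d: "e = r + Suc d" by (auto simp: less_iff_Suc_add)
    then have "of_nat (Suc e choose r) * bernoulli r * of_nat p ^ (Suc e - r) =
        of_nat p ^ 2 * (of_nat (Suc e choose r) * bernoulli r * of_nat p ^ d)"
      by (simp add: power2_eq_square del: binomial_Suc_Suc)
    then show "rat_cong p 2 (of_nat (Suc e choose r) * bernoulli r * of_nat p ^ (Suc e - r)) 0"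
      using d assms by (intro rat_congI[of _ _ "of_nat (Suc e choose r) * bernoulli r * of_nat p ^ d"])
        (simp_all add: p_integral_bernoulli del: binomial_Suc_Suc)
  qed
  then have "rat_cong p 2 ((\<Sum>r<e. of_nat (Suc e choose r) * bernoulli r * of_nat p ^ (Suc e - r)) +
      of_nat (Suc e) * (of_nat p * bernoulli e)) (0 + of_nat (Suc e) * (of_nat p * bernoulli e))"
    using assms by (intro rat_cong_add rat_cong_refl p_integral_mult p_integral_of_nat p_integral_bernoulli)
  also have "(\<Sum>r<e. of_nat (Suc e choose r) * bernoulli r * of_nat p ^ (Suc e - r)) +
      of_nat (Suc e) * (of_nat p * bernoulli e) = of_nat (Suc e) * (\<Sum>i<p. of_nat i ^ e)"
    unfolding faulhaber by (simp add: lessThan_Suc_atMost[symmetric] mult_ac)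
  finally show ?thesis
    unfolding sum_lessThan_power[OF assms(1), symmetric] add_0
    by (rule rat_cong_cancel) (use assms in \<open>intro not_dvd_of_less, auto\<close>)
qed

lemma power_sum_cong_0:
  assumes "0 < e" "e + 2 \<le> p"
  shows "rat_cong p 1 (\<Sum>i = 1..p - 1. of_nat i ^ e) 0"
proof -
  have "rat_cong p 1 (\<Sum>i = 1..p - 1. of_nat i ^ e) (of_nat p * bernoulli e)"
    using power_sum_cong[OF assms] rat_cong_weaken[of 1 1] by (simp add: numeral_2_eq_2)
  also have "rat_cong p 1 (of_nat p * bernoulli e) 0"
    using assms by (intro rat_cong_p_0 p_integral_bernoulli)
  finally show ?thesis .
qed

lemma inverse_powers_cong:
  assumes "m < p" "s \<le> p - 1"
  shows "rat_cong p 1 (harmonic s m) (\<Sum>i = 1..m. of_nat i ^ (p - 1 - s))"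
  unfolding harmonic_def using assms by (intro rat_cong_sum inverse_power_cong) (auto simp: not_dvd_of_less)

text \<open>By Fermat the exponent \<open>- s\<close> becomes \<open>p - 1 - s\<close>, and the two
  bounds on \<open>s\<close> put it in the range of \<open>power_sum_cong_0\<close>.\<close>

lemma harmonic_cong_0:
  assumes "0 < s" "s + 2 \<le> p"
  shows "rat_cong p 1 (harmonic s (p - 1)) 0"
proof -
  have "rat_cong p 1 (harmonic s (p - 1)) (\<Sum>i = 1..p - 1. of_nat i ^ (p - 1 - s))"
    using assms by (intro inverse_powers_cong) auto
  also have "rat_cong p 1 (\<Sum>i = 1..p - 1. of_nat i ^ (p - 1 - s)) 0"
    using assms by (intro power_sum_cong_0) auto
  finally show ?thesis .
qed

text \<open>Adding the terms at \<open>k\<close> and \<open>p - k\<close> gives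
  \<open>p / (k * (p - k))\<close>. The cofactor of \<open>p\<close> is congruent to
  \<open>- H2 (p - 1)\<close>, which vanishes modulo \<open>p\<close> as soon as
  \<open>p > 3\<close>.\<close>

lemma wolstenholme_harmonic:
  assumes "3 < p"
  shows "rat_cong p 2 (H1 (p - 1)) 0"
proof -
  have "2 * H1 (p - 1) = (\<Sum>k = 1..p - 1. 1 / of_nat k) + (\<Sum>k = 1..p - 1. 1 / of_nat (p - k))"
    unfolding harmonic_def using sum_complement[of "\<lambda>k. 1 / of_nat k"] by simp
  also have "\<dots> = of_nat p * (\<Sum>k = 1..p - 1. 1 / of_nat k * (1 / of_nat (p - k)))"
    unfolding sum.distrib[symmetric] sum_distrib_left
    by (intro sum.cong refl) (auto simp: of_nat_diff divide_simps)
  finally have e: "2 * H1 (p - 1) = of_nat p * (\<Sum>k = 1..p - 1. 1 / of_nat k * (1 / of_nat (p - k)))" .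
  have "rat_cong p 1 (\<Sum>k = 1..p - 1. 1 / of_nat k * (1 / of_nat (p - k)))
      (\<Sum>k = 1..p - 1. 1 / of_nat k * (- 1 / of_nat k))"
    by (intro rat_cong_sum rat_cong_mult rat_cong_refl rat_cong_inverse_complement p_integral_inverse)
      (auto simp: not_dvd_of_less)
  also have "(\<Sum>k = 1..p - 1. 1 / of_nat k * (- 1 / of_nat k)) = - H2 (p - 1)"
    unfolding harmonic_def by (simp add: power2_eq_square sum_negf)
  also have "rat_cong p 1 (- H2 (p - 1)) 0"
    using rat_cong_uminus[OF harmonic_cong_0[of 2]] assms by (simp add: numeral_2_eq_2)
  finally have "rat_cong p (1 + 1) (of_nat p ^ 1 * (\<Sum>k = 1..p - 1. 1 / of_nat k * (1 / of_nat (p - k)))) (of_nat p ^ 1 * 0)"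
    by (rule rat_cong_lift)
  then have "rat_cong p 2 (of_nat 2 * H1 (p - 1)) (of_nat 2 * 0)"
    unfolding of_nat_numeral e by (simp only: one_add_one power_one_right mult_zero_right)
  then show ?thesis by (rule rat_cong_cancel) (rule not_dvd_2)
qed

section \<open>The first congruence, modulo the cube of \<open>p\<close>\<close>

text \<open>The binomial is the product of \<open>1 + p / j\<close> over \<open>j\<close> from 1 to
  \<open>m\<close>; only the terms of degree at most 1 in \<open>p\<close> are kept.\<close>

lemma binomial_add_p_cong:
  "m < p \<Longrightarrow> rat_cong p 2 (of_nat (p + m choose m)) (1 + of_nat p * H1 m)"
proof (induction m)
  case (Suc m)
  have inv: "1 / of_nat (Suc m) \<in> p_integral p"
    using Suc by (intro p_integral_inverse not_dvd_of_less) auto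
  have i: "1 + of_nat p / of_nat (Suc m) \<in> p_integral p"
    using p_integral_add[OF p_integral_1 p_integral_mult[OF p_integral_of_nat[of p] inv]] by simp
  have z: "H1 m * (1 / of_nat (Suc m)) \<in> p_integral p"
    using Suc inv by (intro p_integral_mult p_integral_harmonic) auto
  have "rat_cong p 2 (of_nat (p + Suc m choose Suc m)) ((1 + of_nat p * H1 m) * (1 + of_nat p / of_nat (Suc m)))"
    unfolding binomial_add_Suc_rat using Suc i by (intro rat_cong_mult rat_cong_refl) auto
  also have "rat_cong p 2 \<dots> (1 + of_nat p * H1 (Suc m))"
  proof (rule rat_congI[of _ _ "H1 m * (1 / of_nat (Suc m))"])
    show "(1 + of_nat p * H1 m) * (1 + of_nat p / of_nat (Suc m)) - (1 + of_nat p * H1 (Suc m)) =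
        of_nat p ^ 2 * (H1 m * (1 / of_nat (Suc m)))"
      by (simp add: harmonic_Suc algebra_simps power2_eq_square add_divide_distrib del: of_nat_Suc)
  qed (use Suc i z in \<open>auto simp del: of_nat_Suc\<close>)
  finally show ?case .
qed simp

abbreviation q :: rat where "q \<equiv> fermat_quotient p 2"

lemma power_two_fermat: "2 ^ (p - 1) = 1 + of_nat p * q"
  using p_ge_3 by (simp add: fermat_quotient_def)

lemma p_integral_fermat_quotient [simp]: "q \<in> p_integral p"
proof -
  obtain z where "z \<in> p_integral p" "of_nat 2 ^ (p - 1) - 1 = of_nat p ^ 1 * z"
    using fermat_rat[OF not_dvd_2] by (auto simp: rat_cong_def)
  then show ?thesis using p_ge_3 by (simp add: fermat_quotient_def)
qed

text \<open>Exactly, the left side is \<open>p\<close> times the binomial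
  \<open>2 * p - 1 choose (p - 1)\<close> over \<open>4 ^ (p - 1)\<close>, so the cofactor is needed
  modulo the square of \<open>p\<close> only. There the binomial is 1 by Wolstenholme, and
  \<open>4 ^ (p - 1)\<close> is \<open>(1 + p * q) ^ 2\<close>.\<close>

lemma sum_central_p_cong:
  assumes "3 < p"
  shows "rat_cong p 3 (2 * of_nat p * central p) (of_nat p * (1 - 2 * of_nat p * q))"
proof -
  define u :: rat where "u = 1 / 4 ^ (p - 1)"
  have u: "u = 1 / of_nat (2 ^ (p - 1) * 2 ^ (p - 1))"
    unfolding u_def by (simp add: power_mult_distrib[symmetric])
  have "\<not> p dvd 2 ^ (p - 1) * 2 ^ (p - 1)"
    using not_dvd_2 p by (auto simp: prime_dvd_mult_iff dest: prime_dvd_power)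
  then have [simp]: "u \<in> p_integral p"
    unfolding u by (rule p_integral_inverse)
  have u4: "u * (1 + of_nat p * q) ^ 2 = 1"
    unfolding power_two_fermat[symmetric] u_def by (simp add: power2_eq_square power_mult_distrib[symmetric])
  define c :: rat where "c = of_nat (p + (p - 1) choose (p - 1))"
  have "2 * of_nat p * central p = of_nat p * (c * u)"
  proof -
    have "2 * p choose p = 2 * (p + (p - 1) choose (p - 1))"
    proof -
      have "p * (2 * p choose p) = 2 * p * (2 * p - 1 choose (p - 1))"
        using binomial_absorption[of "p - 1" "2 * p"] p_ge_3 by simp
      then have "p * (2 * p choose p) = p * (2 * (2 * p - 1 choose (p - 1)))" by (simp only: mult_ac)
      then have "2 * p choose p = 2 * (2 * p - 1 choose (p - 1))" using p_ge_3 unfolding mult_cancel1 by linarith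
      moreover have "2 * p - 1 = p + (p - 1)" using p_ge_3 by simp
      ultimately show ?thesis by simp
    qed
    moreover have "(4 :: rat) ^ p = 4 * 4 ^ (p - 1)"
      using p_ge_3 by (metis One_nat_def Suc_pred' gr0I not_numeral_le_zero power_Suc)
    ultimately show ?thesis unfolding central_def c_def u_def by simp
  qed
  moreover have "rat_cong p 2 (c * u) (1 - 2 * of_nat p * q)"
  proof -
    have "rat_cong p 2 c (1 + of_nat p * H1 (p - 1))"
      unfolding c_def using p_ge_3 by (intro binomial_add_p_cong) simp
    also have "rat_cong p 2 (1 + of_nat p * H1 (p - 1)) (1 + of_nat p * 0)"
      using wolstenholme_harmonic[OF assms] by (intro rat_cong_add rat_cong_mult rat_cong_refl) auto
    finally have "rat_cong p 2 (c * u) (1 * u)"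
      by (intro rat_cong_mult) auto
    also have "rat_cong p 2 (1 * u) (1 - 2 * of_nat p * q)"
    \<comment> \<open>With \<open>x = p * q\<close>, the witness comes from
      \<open>1 - (1 - 2 * x) * (1 + x) ^ 2 = 3 * x ^ 2 + 2 * x ^ 3\<close>.\<close>
    proof (rule rat_congI[of _ _ "u * (3 * q ^ 2 + 2 * of_nat p * q ^ 3)"])
      have "1 * u - (1 - 2 * of_nat p * q) = u * 1 - (1 - 2 * of_nat p * q) * (u * (1 + of_nat p * q) ^ 2)"
        by (simp only: u4) simp
      also have "\<dots> = of_nat p ^ 2 * (u * (3 * q ^ 2 + 2 * of_nat p * q ^ 3))"
        by (simp add: algebra_simps power2_eq_square power3_eq_cube)
      finally show "1 * u - (1 - 2 * of_nat p * q) = of_nat p ^ 2 * (u * (3 * q ^ 2 + 2 * of_nat p * q ^ 3))" .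
    qed auto
    finally show ?thesis .
  qed
  moreover have "1 + 2 = (3 :: nat)" by simp
  ultimately show ?thesis
    using rat_cong_lift[of 2 "c * u" "1 - 2 * of_nat p * q" 1] by (simp only: power_one_right)
qed

lemma sum_central_harmonic_cong:
  assumes "3 < p"
  shows "rat_cong p 3 (\<Sum>k = 1..p - 1. central k * H1 k) (2 - 2 * of_nat p + 4 * of_nat p ^ 2 * q)"
proof -
  define A where "A = 2 * of_nat p * central p"
  note A = sum_central_p_cong[OF assms, folded A_def]
  have S: "(\<Sum>k = 1..p - 1. central k * H1 k) = 2 + (A * H1 (p - 1) - 2 * A)"
    using sum_central_harmonic[of "p - 1"] p_ge_3 by (simp add: A_def algebra_simps)
  have Hint: "H1 (p - 1) \<in> p_integral p" using p_ge_3 by simp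
  have "rat_cong p 3 (A * H1 (p - 1)) (of_nat p * (1 - 2 * of_nat p * q) * H1 (p - 1))"
    using A Hint by (intro rat_cong_mult rat_cong_refl)
  \<comment> \<open>One factor \<open>p\<close> is explicit and Wolstenholme's congruence
    contributes the other two.\<close>
  also have "rat_cong p 3 (of_nat p * (1 - 2 * of_nat p * q) * H1 (p - 1)) 0"
  proof -
    have "rat_cong p 2 ((1 - 2 * of_nat p * q) * H1 (p - 1)) ((1 - 2 * of_nat p * q) * 0)"
      using wolstenholme_harmonic[OF assms] by (intro rat_cong_mult rat_cong_refl) auto
    from rat_cong_lift[OF this, of 1] show ?thesis by (simp add: numeral_3_eq_3 mult_ac)
  qed
  finally have "rat_cong p 3 (\<Sum>k = 1..p - 1. central k * H1 k) (2 + (0 - 2 * (of_nat p * (1 - 2 * of_nat p * q))))"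
    unfolding S using A by (intro rat_cong_add rat_cong_diff rat_cong_refl rat_cong_mult) auto
  also have "2 + (0 - 2 * (of_nat p * (1 - 2 * of_nat p * q))) = 2 - 2 * of_nat p + 4 * of_nat p ^ 2 * q"
    by (simp add: algebra_simps power2_eq_square)
  finally show ?thesis .
qed

section \<open>The second congruence, modulo \<open>p\<close>\<close>

text \<open>Neighbouring entries of row \<open>p - 1\<close> add up to an inner entry of row
  \<open>p\<close>, which is divisible by \<open>p\<close>; hence the sign alternates.\<close>

lemma binomial_pred_cong: "k < p \<Longrightarrow> rat_cong p 1 (of_nat (p - 1 choose k)) ((-1) ^ k)"
proof (induction k)
  case (Suc k)
  have "of_nat (p - 1 choose k) + of_nat (p - 1 choose Suc k) = (of_nat (p choose Suc k) :: rat)"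
    using binomial_Suc_Suc[of "p - 1" k] p_ge_3 by (simp add: of_nat_add[symmetric] del: of_nat_add binomial_Suc_Suc)
  moreover have "p dvd (p choose Suc k)"
    using Suc p by (intro dvd_choose_prime) auto
  then obtain z where "p choose Suc k = p * z" by (elim dvdE)
  ultimately have "of_nat (p - 1 choose Suc k) = of_nat p * rat_of_nat z - of_nat (p - 1 choose k)"
    by (simp add: eq_diff_eq add.commute)
  moreover have "rat_cong p 1 (of_nat p * rat_of_nat z - of_nat (p - 1 choose k)) (0 - (-1) ^ k)"
    using Suc by (intro rat_cong_diff rat_cong_p_0) auto
  ultimately show ?case by simp
qed simp

text \<open>The inner entries of row \<open>p\<close> sum to \<open>2 ^ p - 2 = 2 * p * q\<close>,
  and each is \<open>p / k\<close> times an entry of row \<open>p - 1\<close>. Dividing by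
  \<open>p\<close> leaves \<open>2 * q\<close>, congruent to an alternating harmonic sum.\<close>

lemma harmonic_half_cong: "rat_cong p 1 (H1 half) (- 2 * q)"
proof -
  have "of_nat p * (2 * q) = 2 ^ p - 2"
  proof -
    have "(2 :: rat) ^ p = 2 * 2 ^ (p - 1)"
      using p_ge_3 by (metis One_nat_def Suc_pred' gr0I not_numeral_le_zero power_Suc)
    then show ?thesis by (simp only: power_two_fermat) (simp add: algebra_simps)
  qed
  also have "\<dots> = (\<Sum>k = 1..p - 1. of_nat (p choose k))"
  proof -
    have "(2 :: rat) ^ p = (\<Sum>k\<le>p. of_nat (p choose k))"
      using choose_row_sum[of p] by (metis of_nat_numeral of_nat_power of_nat_sum)
    also have "{..p} = insert 0 (insert p {1..p - 1})" using p_ge_3 by auto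
    also have "(\<Sum>k\<in>insert 0 (insert p {1..p - 1}). of_nat (p choose k)) = 2 + (\<Sum>k = 1..p - 1. of_nat (p choose k) :: rat)"
      using p_ge_3 by (subst sum.insert; simp)+
    finally show ?thesis by simp
  qed
  also have "\<dots> = of_nat p * (\<Sum>k = 1..p - 1. of_nat (p - 1 choose (k - 1)) / of_nat k)"
    unfolding sum_distrib_left
  proof (intro sum.cong refl)
    fix k assume "k \<in> {1..p - 1}"
    then obtain j where k: "k = Suc j" by (cases k) auto
    have "of_nat k * of_nat (p choose k) = (of_nat p * of_nat (p - 1 choose (k - 1)) :: rat)"
      using binomial_absorption[of j p] unfolding k of_nat_mult[symmetric] by (simp only: diff_Suc_1)
    then show "of_nat (p choose k) = of_nat p * (of_nat (p - 1 choose (k - 1)) / rat_of_nat k)"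
      unfolding k by (simp add: eq_divide_eq mult_ac del: of_nat_Suc)
  qed
  finally have "2 * q = (\<Sum>k = 1..p - 1. of_nat (p - 1 choose (k - 1)) / of_nat k)"
    using p_ge_3 by simp
  also have "rat_cong p 1 \<dots> (\<Sum>k = 1..p - 1. (-1) ^ (k - 1) / of_nat k)"
    by (intro rat_cong_sum rat_cong_divide binomial_pred_cong) (auto simp: not_dvd_of_less)
  also have "(\<Sum>k = 1..p - 1. (-1) ^ (k - 1) / of_nat k) = H1 (p - 1) - H1 half"
    unfolding p_minus_1 by (rule alternating_harmonic)
  also have "rat_cong p 1 (H1 (p - 1) - H1 half) (0 - H1 half)"
    using p_ge_3 half_less by (intro rat_cong_diff harmonic_cong_0 rat_cong_refl) auto
  finally show ?thesis using rat_cong_sym[OF rat_cong_uminus, of 1 "2 * q" "- H1 half"] by simp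
qed

text \<open>Both sides satisfy first-order recurrences with denominator \<open>2 * (k + 1)\<close>;
  the numerators \<open>2 * k + 1\<close> and \<open>2 * k - 2 * half\<close> differ by exactly
  \<open>p\<close>.\<close>

lemma central_cong: "k \<le> half \<Longrightarrow> rat_cong p 1 (central k) ((-1) ^ k * of_nat (half choose k))"
proof (induction k)
  case (Suc k)
  have nd: "\<not> p dvd (2 * (k + 1))"
    using Suc.prems p_eq by (intro not_dvd_of_less) auto
  have "rat_cong p 1 (of_nat (2 * k + 1)) (2 * of_nat k - 2 * of_nat half)"
  proof (rule rat_congI[of _ _ 1])
    have "(of_nat p :: rat) = 2 * of_nat half + 1" by (subst p_eq) simp
    then show "of_nat (2 * k + 1) - (2 * of_nat k - 2 * of_nat half) = of_nat p ^ 1 * (1 :: rat)" by simp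
  qed auto
  with Suc have "rat_cong p 1 (central (Suc k))
      ((-1) ^ k * of_nat (half choose k) * (2 * of_nat k - 2 * of_nat half) / of_nat (2 * (k + 1)))"
    unfolding central_Suc by (intro rat_cong_divide[OF _ nd] rat_cong_mult) auto
  also have "(-1) ^ k * of_nat (half choose k) * (2 * of_nat k - 2 * of_nat half) / of_nat (2 * (k + 1)) =
      (-1) ^ Suc k * rat_of_nat (half choose Suc k)"
  proof -
    have "(2 * of_nat k - 2 * of_nat half) / of_nat (2 * (k + 1)) = - ((of_nat half - of_nat k) / rat_of_nat (Suc k))"
      by (simp add: divide_simps) (simp add: algebra_simps)
    then show ?thesis
      by (simp only: binomial_Suc_rat times_divide_eq_right[symmetric] power_Suc)
  qed
  finally show ?case .
qed simp

lemma sum_central_cong_alt_sum: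
  assumes "\<And>k. 0 < k \<Longrightarrow> k \<le> half \<Longrightarrow> f k \<in> p_integral p"
  shows "rat_cong p 1 (\<Sum>k = 1..half. central k * f k) (alt_sum half f)"
  unfolding alt_sum_def using assms by (intro rat_cong_sum rat_cong_mult central_cong rat_cong_refl) auto

lemma sum_central_harmonic2_cong:
  "rat_cong p 1 (\<Sum>k = 0..half. central k * H2 k) (- 4 * q)"
proof -
  have int: "H2 k \<in> p_integral p" if "k \<le> half" for k using that half_less by simp
  have aint: "alt_sum half H2 \<in> p_integral p"
    unfolding alt_sum_def using int p_integral_of_int[of "-1"] by (intro p_integral_sum p_integral_mult p_integral_power) auto
  have "(\<Sum>k = 0..half. central k * H2 k) = (\<Sum>k = 1..half. central k * H2 k)"
    by (simp add: sum.atLeast_Suc_atMost)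
  also have "rat_cong p 1 \<dots> (alt_sum half H2)"
    using int by (intro sum_central_cong_alt_sum)
  also have "rat_cong p 1 (alt_sum half H2) (2 * H1 half)"
  \<comment> \<open>Replacing \<open>H1 half\<close> by \<open>- half * alt_sum half H2\<close>
    turns the difference into \<open>(1 + 2 * half) * alt_sum half H2\<close>.\<close>
  proof (rule rat_congI[of _ _ "alt_sum half H2"])
    have "(of_nat p :: rat) = 2 * of_nat half + 1" by (subst p_eq) simp
    then show "alt_sum half H2 - 2 * H1 half = of_nat p ^ 1 * alt_sum half H2"
      using alt_sum_harmonic2[of half] by (simp add: algebra_simps)
  qed (use aint half_less in auto)
  also have "rat_cong p 1 (2 * H1 half) (2 * (- 2 * q))"
    by (rule rat_cong_cmult[OF _ harmonic_half_cong]) simp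
  finally show ?thesis by simp
qed

section \<open>The third congruence and the Bernoulli number\<close>

lemma add_p_power_cong:
  assumes "y \<in> p_integral p"
  shows "rat_cong p 2 ((of_nat p + y) ^ Suc k) (y ^ Suc k + of_nat (Suc k) * of_nat p * y ^ k)"
proof (induction k)
  case 0
  then show ?case using assms by (simp add: add.commute)
next
  case (Suc k)
  have "rat_cong p 2 ((of_nat p + y) * (of_nat p + y) ^ Suc k) ((of_nat p + y) * (y ^ Suc k + of_nat (Suc k) * of_nat p * y ^ k))"
    using Suc assms by (intro rat_cong_cmult) auto
  also have "rat_cong p 2 ((of_nat p + y) * (y ^ Suc k + of_nat (Suc k) * of_nat p * y ^ k))
      (y ^ Suc (Suc k) + of_nat (Suc (Suc k)) * of_nat p * y ^ Suc k)"
    using assms by (intro rat_congI[of _ _ "of_nat (Suc k) * y ^ k"])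
      (simp_all add: algebra_simps power2_eq_square)
  finally show ?case by simp
qed

text \<open>Voronoi's congruence for the multiplier 2: the residues of \<open>2 j\<close> permute those of \<open>j\<close>, so the
  two evaluations of the power sum \<open>S\<close> modulo \<open>p\<^sup>2\<close> below determine \<open>(1 - 2 ^ (p - 3)) S\<close>.\<close>

lemma harmonic3_half_cong:
  assumes "3 < p"
  shows "rat_cong p 1 (harmonic 3 half) (- 2 * bernoulli (p - 3))"
proof -
  \<comment> \<open>By Fermat, the power \<open>e\<close> acts as the power \<open>- 3\<close>, so
    \<open>U\<close> below stands for \<open>harmonic 3 half\<close>. The exponent
    \<open>Suc e = p - 3\<close> of \<open>S\<close> is even, so reflection keeps its leading
    term.\<close>
  define e where "e = p - 4"
  have e: "p - 3 = Suc e" "odd e" and pe: "p = e + 4"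
    using assms odd_p unfolding e_def by auto
  define S :: rat where "S = (\<Sum>i = 1..p - 1. of_nat i ^ Suc e)"
  define V :: rat where "V = (\<Sum>i = 1..half. of_nat i ^ Suc e)"
  define U :: rat where "U = (\<Sum>i = 1..half. of_nat i ^ e)"
  define b where "b = bernoulli (p - 3)"
  have bint: "b \<in> p_integral p" unfolding b_def using assms by (intro p_integral_bernoulli) auto
  have Uint: "U \<in> p_integral p" unfolding U_def by (intro p_integral_sum) simp
  have Sb: "rat_cong p 2 S (of_nat p * b)"
    unfolding S_def b_def e(1)[symmetric] using assms by (intro power_sum_cong) auto
  have refl: "rat_cong p 2 (of_nat (p - i) ^ Suc e) (of_nat i ^ Suc e - of_nat (Suc e) * of_nat p * of_nat i ^ e)"
    if "i \<le> p" for i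
  proof -
    have "even (Suc e)" using e(2) by simp
    then show ?thesis
      using add_p_power_cong[of "- of_nat i" e] that e(2)
      by (simp add: of_nat_diff power_minus_odd power_minus_even del: power_Suc of_nat_Suc)
  qed
  have Uk: "(\<Sum>i = 1..half. of_nat (Suc e) * of_nat p * of_nat i ^ e) = of_nat (Suc e) * of_nat p * U"
    unfolding U_def sum_distrib_left by simp
  \<comment> \<open>First evaluation: \<open>i\<close> is paired with \<open>p - i\<close>.\<close>
  have S1: "rat_cong p 2 S (2 * V - of_nat (Suc e) * of_nat p * U)"
  proof -
    have "rat_cong p 2 S (\<Sum>i = 1..half. of_nat i ^ Suc e + (of_nat i ^ Suc e - of_nat (Suc e) * of_nat p * of_nat i ^ e))"
      unfolding S_def sum_fold using half_less
      by (intro rat_cong_sum rat_cong_add refl rat_cong_refl p_integral_power p_integral_of_nat) auto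
    also have "(\<Sum>i = 1..half. of_nat i ^ Suc e + (of_nat i ^ Suc e - of_nat (Suc e) * of_nat p * of_nat i ^ e)) =
        2 * V - of_nat (Suc e) * of_nat p * U"
      by (simp only: sum.distrib sum_subtractf Uk) (simp add: V_def)
    finally show ?thesis .
  qed
  have idx: "p - 2 * (Suc half - i) = 2 * i - 1" if "Suc 0 \<le> i" "i \<le> half" for i
    using p_eq that by simp
  \<comment> \<open>Second evaluation: the even numbers below \<open>p\<close> are the
    \<open>2 * i\<close>, the odd ones the \<open>p - 2 * i\<close>.\<close>
  have S2: "rat_cong p 2 S (2 * 2 ^ Suc e * V - of_nat (Suc e) * of_nat p * 2 ^ e * U)"
  proof -
    have odd_sum: "(\<Sum>i = 1..half. of_nat (2 * i - 1) ^ Suc e) = (\<Sum>i = 1..half. (of_nat (p - 2 * i) :: rat) ^ Suc e)"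
      by (rule sum.reindex_bij_witness[of _ "\<lambda>i. Suc half - i" "\<lambda>i. Suc half - i"])
        (auto simp: idx simp del: of_nat_diff power_Suc of_nat_Suc)
    have S_eq: "S = (\<Sum>i = 1..half. of_nat (2 * i) ^ Suc e) + (\<Sum>i = 1..half. of_nat (p - 2 * i) ^ Suc e)"
      unfolding S_def p_minus_1 sum_odd_even sum.distrib odd_sum ..
    have "rat_cong p 2 S ((\<Sum>i = 1..half. of_nat (2 * i) ^ Suc e) +
         (\<Sum>i = 1..half. of_nat (2 * i) ^ Suc e - of_nat (Suc e) * of_nat p * of_nat (2 * i) ^ e))"
      unfolding S_eq
    proof (rule rat_cong_add[OF rat_cong_refl rat_cong_sum[OF refl]])
      show "2 * i \<le> p" if "i \<in> {1..half}" for i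
        using that two_half_less by simp
    qed (intro p_integral_sum p_integral_power p_integral_of_nat)
    also have "(\<Sum>i = 1..half. of_nat (2 * i) ^ Suc e) +
         (\<Sum>i = 1..half. of_nat (2 * i) ^ Suc e - of_nat (Suc e) * of_nat p * of_nat (2 * i) ^ e) =
         2 * 2 ^ Suc e * V - of_nat (Suc e) * of_nat p * 2 ^ e * U"
    proof -
      have "(\<Sum>i = 1..half. (of_nat (2 * i) :: rat) ^ Suc e) = 2 ^ Suc e * V"
        unfolding V_def sum_distrib_left by (simp only: of_nat_mult of_nat_numeral power_mult_distrib)
      moreover have "(\<Sum>i = 1..half. of_nat (Suc e) * of_nat p * (of_nat (2 * i) :: rat) ^ e) = of_nat (Suc e) * of_nat p * 2 ^ e * U"
        unfolding U_def sum_distrib_left by (simp only: of_nat_mult of_nat_numeral power_mult_distrib mult.assoc)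
      ultimately show ?thesis by (simp only: sum_subtractf)
    qed
    finally show ?thesis .
  qed
  \<comment> \<open>Subtracting \<open>2 ^ Suc e\<close> times the first evaluation from the second
    eliminates \<open>V\<close> and leaves a multiple of \<open>p\<close>.\<close>
  have "rat_cong p 2 (S - 2 ^ Suc e * S)
      ((2 * 2 ^ Suc e * V - of_nat (Suc e) * of_nat p * 2 ^ e * U) - 2 ^ Suc e * (2 * V - of_nat (Suc e) * of_nat p * U))"
    by (intro rat_cong_diff rat_cong_cmult S1 S2 p_integral_power p_integral_numeral)
  also have "(2 * 2 ^ Suc e * V - of_nat (Suc e) * of_nat p * 2 ^ e * U) - 2 ^ Suc e * (2 * V - of_nat (Suc e) * of_nat p * U) =
      of_nat p * (of_nat (Suc e) * 2 ^ e * U)"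
    by (simp add: algebra_simps)
  finally have r: "rat_cong p 2 (S - 2 ^ Suc e * S) (of_nat p * (of_nat (Suc e) * 2 ^ e * U))" .
  have "rat_cong p 2 (of_nat p * b - 2 ^ Suc e * (of_nat p * b)) (S - 2 ^ Suc e * S)"
    by (intro rat_cong_diff rat_cong_cmult rat_cong_sym[OF Sb] p_integral_power p_integral_numeral)
  also note r
  also have "of_nat p * b - 2 ^ Suc e * (of_nat p * b) = of_nat p * ((1 - 2 ^ Suc e) * b)"
    by (simp add: algebra_simps)
  finally have "rat_cong p (Suc 1) (of_nat p * ((1 - 2 ^ Suc e) * b)) (of_nat p * (of_nat (Suc e) * 2 ^ e * U))"
    by (simp only: Suc_1)
  then have "rat_cong p 1 ((1 - 2 ^ Suc e) * b) (of_nat (Suc e) * 2 ^ e * U)"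
    by (rule rat_cong_cancel_p) (use bint Uint in \<open>auto simp del: of_nat_Suc\<close>)
  \<comment> \<open>The factor 8 raises both powers of 2 to multiples of \<open>2 ^ (p - 1)\<close>,
    which Fermat replaces by 1.\<close>
  then have "rat_cong p 1 (8 * ((1 - 2 ^ Suc e) * b)) (8 * (of_nat (Suc e) * 2 ^ e * U))"
    by (intro rat_cong_cmult) auto
  moreover have "8 * ((1 - 2 ^ Suc e) * b) = (8 - 2 * 2 ^ (p - 1)) * b" "8 * (of_nat (Suc e) * 2 ^ e * U) = of_nat (p - 3) * 2 ^ (p - 1) * U"
    unfolding e(1) by (simp_all add: pe algebra_simps power_add eval_nat_numeral)
  ultimately have m: "rat_cong p 1 ((8 - 2 * 2 ^ (p - 1)) * b) (of_nat (p - 3) * 2 ^ (p - 1) * U)"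
    by (simp only:)
  have f: "rat_cong p 1 (2 ^ (p - 1)) 1" using fermat_rat[OF not_dvd_2] by simp
  have "rat_cong p 1 (- of_nat 3 * 1 * U) (of_nat (p - 3) * 2 ^ (p - 1) * U)"
    using assms Uint f by (intro rat_cong_mult rat_cong_sym[OF rat_cong_of_nat_complement] rat_cong_sym[OF f]) auto
  also note rat_cong_sym[OF m]
  also have "rat_cong p 1 ((8 - 2 * 2 ^ (p - 1)) * b) ((8 - 2 * 1) * b)"
    using bint f by (intro rat_cong_mult rat_cong_diff rat_cong_refl) auto
  finally have "rat_cong p 1 (of_nat 3 * (- U)) (of_nat 3 * (2 * b))" by simp
  then have "rat_cong p 1 (- U) (2 * b)"
    by (rule rat_cong_cancel) (use assms in \<open>intro not_dvd_of_less, auto\<close>)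
  then have "rat_cong p 1 U (- 2 * b)" using rat_cong_uminus[of 1 "- U"] by simp
  moreover have "rat_cong p 1 (harmonic 3 half) U"
    unfolding U_def using inverse_powers_cong[OF half_less, of 3] assms by (simp add: e_def)
  ultimately show ?thesis unfolding b_def by (rule rat_cong_trans[rotated])
qed

text \<open>Starting from \<open>H1 (p - 1)\<close>, which is 0 modulo \<open>p\<close>, each step
  down removes a term congruent to \<open>- 1 / of_nat (Suc j)\<close>.\<close>

lemma harmonic_complement_cong: "j < p \<Longrightarrow> rat_cong p 1 (H1 (p - 1 - j)) (H1 j)"
proof (induction j)
  case 0
  then show ?case using harmonic_cong_0[of 1] p_ge_3 by simp
next
  case (Suc j)
  define i where "i = p - 1 - Suc j"
  have i: "p - 1 - j = Suc i" "p - Suc j = Suc i" using Suc.prems by (auto simp: i_def)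
  have "H1 i = H1 (p - 1 - j) - 1 / of_nat (p - Suc j)" unfolding i harmonic_Suc by simp
  also have "rat_cong p 1 \<dots> (H1 j - (- 1 / of_nat (Suc j)))"
    using Suc by (intro rat_cong_diff rat_cong_inverse_complement) auto
  also have "H1 j - (- 1 / of_nat (Suc j)) = H1 (Suc j)" by (simp add: harmonic_Suc)
  finally show ?case by (simp only: i_def)
qed

text \<open>Fermat makes \<open>H1 (j - 1)\<close> a sum of powers \<open>i ^ (p - 2)\<close>, which
  Faulhaber expands in powers of \<open>j\<close>. After the sums are swapped, the sum over
  \<open>j\<close> vanishes modulo \<open>p\<close> except where \<open>j\<close> has total exponent
  0, at \<open>r = p - 3\<close>.\<close>

lemma sum_harmonic_pred_div_square_cong:
  assumes "3 < p"
  shows "rat_cong p 1 (\<Sum>j = 1..p - 1. H1 (j - 1) / of_nat j ^ 2) (bernoulli (p - 3))"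
proof -
  define b where "b = bernoulli (p - 3)"
  have bint: "b \<in> p_integral p" unfolding b_def using assms by (intro p_integral_bernoulli) auto
  define T where "T = (\<Sum>j = 1..p - 1. H1 (j - 1) / of_nat j ^ 2)"
  have Tint: "T \<in> p_integral p"
    unfolding T_def by (intro p_integral_sum p_integral_divide_power p_integral_harmonic) (auto simp: not_dvd_of_less)
  have H: "rat_cong p 1 (H1 (j - 1)) (\<Sum>i<j. of_nat i ^ (p - 2))" if "j \<in> {1..p - 1}" for j
  proof -
    have "rat_cong p 1 (H1 (j - 1)) (\<Sum>i = 1..j - 1. of_nat i ^ (p - 1 - 1))"
      using that p_ge_3 by (intro inverse_powers_cong) auto
    \<comment> \<open>The added term at \<open>i = 0\<close> is 0 because the exponent is
      positive.\<close>
    also have "(\<Sum>i = 1..j - 1. of_nat i ^ (p - 1 - 1)) = (\<Sum>i<j. (of_nat i :: rat) ^ (p - 2))"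
      using that p_ge_3 by (intro sum.mono_neutral_cong_left) (auto simp: not_le numeral_2_eq_2)
    finally show ?thesis .
  qed
  have Sp: "Suc (p - 2) = p - 1" using p_ge_3 by simp
  have X: "rat_cong p 1 (\<Sum>j = 1..p - 1. of_nat j ^ (p - 1 - r) / of_nat j ^ 2) (if r = p - 3 then - 1 else 0)"
    if "r \<le> p - 2" for r
  proof -
    have "r = p - 2 \<or> r = p - 3 \<or> r < p - 3" using that by linarith
    then consider "r = p - 2" | "r = p - 3" | "r < p - 3" by blast
    then show ?thesis
    proof cases
      case 1
      then have "p - 1 - r = 1" using p_ge_3 by auto
      then have "(\<Sum>j = 1..p - 1. of_nat j ^ (p - 1 - r) / of_nat j ^ 2) = H1 (p - 1)"
        unfolding harmonic_def by (simp add: power2_eq_square)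
      then show ?thesis using harmonic_cong_0[of 1] 1 p_ge_3 by auto
    next
      case 2
      then have "p - 1 - r = 2" using assms by auto
      then have "(\<Sum>j = 1..p - 1. of_nat j ^ (p - 1 - r) / rat_of_nat j ^ 2) = of_nat (p - 1)"
        by simp
      then show ?thesis using 2 rat_cong_of_nat_complement[of 1] p_ge_3 by simp
    next
      case 3
      then have r: "p - 1 - r = 2 + (p - 3 - r)" by auto
      have "(\<Sum>j = 1..p - 1. of_nat j ^ (p - 1 - r) / rat_of_nat j ^ 2) = (\<Sum>j = 1..p - 1. of_nat j ^ (p - 3 - r))"
        unfolding r power_add by (intro sum.cong) auto
      then show ?thesis using power_sum_cong_0[of "p - 3 - r"] 3 by auto
    qed
  qed
  have "rat_cong p 1 (of_nat (p - 1) * T) (of_nat (p - 1) * (\<Sum>j = 1..p - 1. (\<Sum>i<j. of_nat i ^ (p - 2)) * (1 / of_nat j ^ 2)))"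
  proof -
    have "T = (\<Sum>j = 1..p - 1. H1 (j - 1) * (1 / of_nat j ^ 2))" by (simp add: T_def)
    then show ?thesis
      by (simp only:) (intro rat_cong_cmult rat_cong_sum rat_cong_mult H rat_cong_refl p_integral_of_nat p_integral_divide_power p_integral_1,
        auto simp: not_dvd_of_less)
  qed
  also have "of_nat (p - 1) * (\<Sum>j = 1..p - 1. (\<Sum>i<j. of_nat i ^ (p - 2)) * (1 / of_nat j ^ 2)) =
      (\<Sum>j = 1..p - 1. (\<Sum>r\<le>p - 2. of_nat (p - 1 choose r) * bernoulli r * of_nat j ^ (p - 1 - r)) * (1 / of_nat j ^ 2))"
    unfolding faulhaber[of "p - 2", unfolded Sp, symmetric] sum_distrib_left[of "of_nat (p - 1)" _ "{1..p - 1}"]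
    by (simp only: mult.assoc)
  also have "\<dots> = (\<Sum>j = 1..p - 1. \<Sum>r\<le>p - 2. of_nat (p - 1 choose r) * bernoulli r * (of_nat j ^ (p - 1 - r) / of_nat j ^ 2))"
    unfolding sum_distrib_right by simp
  also have "\<dots> = (\<Sum>r\<le>p - 2. of_nat (p - 1 choose r) * bernoulli r * (\<Sum>j = 1..p - 1. of_nat j ^ (p - 1 - r) / of_nat j ^ 2))"
    unfolding sum_distrib_left by (rule sum.swap)
  also have "rat_cong p 1 \<dots> (\<Sum>r\<le>p - 2. of_nat (p - 1 choose r) * bernoulli r * (if r = p - 3 then - 1 else 0))"
    using p_ge_3 by (intro rat_cong_sum rat_cong_cmult X p_integral_mult p_integral_of_nat p_integral_bernoulli) auto
  also have "(\<Sum>r\<le>p - 2. of_nat (p - 1 choose r) * bernoulli r * (if r = p - 3 then - 1 else 0)) = of_nat (p - 1 choose (p - 3)) * (- b)"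
  proof -
    have "(\<Sum>r\<le>p - 2. of_nat (p - 1 choose r) * bernoulli r * (if r = p - 3 then - 1 else 0)) =
        (\<Sum>r\<le>p - 2. if r = p - 3 then of_nat (p - 1 choose (p - 3)) * (- b) else 0)"
      by (intro sum.cong) (auto simp: b_def)
    also have "\<dots> = of_nat (p - 1 choose (p - 3)) * (- b)" by (simp add: sum.delta)
    finally show ?thesis .
  qed
  also have "rat_cong p 1 \<dots> ((-1) ^ (p - 3) * (- b))"
    using bint assms by (intro rat_cong_mult binomial_pred_cong rat_cong_refl) auto
  also have "(-1) ^ (p - 3) * (- b) = - b" using odd_p assms by simp
  \<comment> \<open>The left side is \<open>T\<close> itself, which removes Faulhaber's factor
    \<open>p - 1\<close> without a division.\<close>
  finally have "rat_cong p 1 (of_nat p * T - of_nat (p - 1) * T) (0 - (- b))"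
    using Tint by (intro rat_cong_diff rat_cong_p_0)
  then show ?thesis using p_ge_3 unfolding T_def[symmetric] b_def[symmetric] by (simp add: of_nat_diff algebra_simps)
qed

text \<open>Folding the previous sum at \<open>p - j\<close> gives \<open>H1 (j - 1) + H1 j\<close>
  over \<open>j ^ 2\<close>, that is, twice the wanted term minus \<open>1 / j ^ 3\<close>. With
  \<open>b\<close> for the Bernoulli number, the result is \<open>b - 2 * b\<close>.\<close>

lemma sum_harmonic_div_square_half_cong:
  assumes "3 < p"
  shows "rat_cong p 1 (2 * (\<Sum>j = 1..half. H1 j / of_nat j ^ 2)) (- bernoulli (p - 3))"
proof -
  define b where "b = bernoulli (p - 3)"
  have "b \<in> p_integral p" unfolding b_def using assms by (intro p_integral_bernoulli) auto
  have nd: "\<not> p dvd j" if "j \<in> {1..half}" for j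
    using that half_less by (intro not_dvd_of_less) auto
  have "rat_cong p 1 (\<Sum>j = 1..p - 1. H1 (j - 1) / of_nat j ^ 2)
      (\<Sum>j = 1..half. H1 (j - 1) / of_nat j ^ 2 + H1 j * ((- 1) ^ 2 / of_nat j ^ 2))"
    unfolding sum_fold
  proof (intro rat_cong_sum rat_cong_add rat_cong_refl)
    fix j assume j: "j \<in> {1..half}"
    show "H1 (j - 1) / of_nat j ^ 2 \<in> p_integral p"
      using j half_less by (intro p_integral_divide_power nd p_integral_harmonic) auto
    have "rat_cong p 1 (H1 (p - 1 - j) * (1 / of_nat (p - j) ^ 2)) (H1 j * ((- 1) ^ 2 / of_nat j ^ 2))"
      using j half_less by (intro rat_cong_mult harmonic_complement_cong rat_cong_inverse_power_complement) auto
    then show "rat_cong p 1 (H1 (p - j - 1) / of_nat (p - j) ^ 2) (H1 j * ((- 1) ^ 2 / of_nat j ^ 2))"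
      by (simp add: diff_commute)
  qed
  also have "(\<Sum>j = 1..half. H1 (j - 1) / of_nat j ^ 2 + H1 j * ((- 1) ^ 2 / of_nat j ^ 2)) =
      (\<Sum>j = 1..half. 2 * (H1 j / of_nat j ^ 2) - 1 / of_nat j ^ 3)"
  proof (intro sum.cong refl)
    fix j assume "j \<in> {1..half}"
    then obtain i where "j = Suc i" by (cases j) auto
    then show "H1 (j - 1) / of_nat j ^ 2 + H1 j * ((- 1) ^ 2 / of_nat j ^ 2) = 2 * (H1 j / of_nat j ^ 2) - 1 / rat_of_nat j ^ 3"
      by (simp add: harmonic_Suc add_divide_distrib power2_eq_square power3_eq_cube del: of_nat_Suc)
  qed
  also have "\<dots> = 2 * (\<Sum>j = 1..half. H1 j / of_nat j ^ 2) - harmonic 3 half"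
    unfolding harmonic_def[of 3] sum_subtractf sum_distrib_left ..
  finally have "rat_cong p 1 (2 * (\<Sum>j = 1..half. H1 j / of_nat j ^ 2) - harmonic 3 half) b"
    unfolding b_def by (rule rat_cong_trans[OF rat_cong_sym sum_harmonic_pred_div_square_cong[OF assms]])
  from rat_cong_add[OF this harmonic3_half_cong[OF assms, folded b_def]]
  show ?thesis unfolding b_def by simp
qed

lemma sum_central_harmonic2_divide_cong:
  "rat_cong p 1 (\<Sum>k = 1..half. central k * (H2 k / of_nat k)) (bernoulli (p - 3) / 2)"
proof (cases "p = 3")
  \<comment> \<open>The Bernoulli evaluations above assume \<open>p > 3\<close>; for
    \<open>p = 3\<close> the sum is its single term \<open>1 / 2\<close>, and
    \<open>bernoulli 0 = 1\<close>.\<close>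
  case True
  then have "half = 1" unfolding half_def by simp
  then have "(\<Sum>k = 1..half. central k * (H2 k / of_nat k)) = 1 / of_nat 2"
    by (simp add: central_def harmonic_def)
  moreover have "bernoulli (p - 3) / 2 = 1 / of_nat 2"
    using True by (simp add: bernoulli_0)
  moreover have "rat_cong p 1 (1 / of_nat 2) (1 / of_nat 2)"
    by (rule rat_cong_refl[OF p_integral_inverse[OF not_dvd_2]])
  ultimately show ?thesis by (simp only:)
next
  case False
  then have p3: "3 < p" using p_ge_3 by simp
  have "H2 k / of_nat k \<in> p_integral p" if "0 < k" "k \<le> half" for k
    using that half_less by (intro p_integral_divide p_integral_harmonic not_dvd_of_less) auto
  then have "rat_cong p 1 (\<Sum>k = 1..half. central k * (H2 k / of_nat k)) (alt_sum half (\<lambda>k. H2 k / of_nat k))"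
    by (rule sum_central_cong_alt_sum)
  also have "rat_cong p 1 (alt_sum half (\<lambda>k. H2 k / of_nat k)) (bernoulli (p - 3) / 2)"
    unfolding alt_sum_harmonic2_divide
    by (rule rat_cong_cancel[OF _ not_dvd_2])
      (use rat_cong_uminus[OF sum_harmonic_div_square_half_cong[OF p3]] in simp)
  finally show ?thesis .
qed

end

theorem theorem1p3:
  fixes p :: nat
  assumes "prime p" and "odd p"
  shows "(p > 3 \<longrightarrow>
            rat_cong p 3
              (\<Sum>k = 1..p - 1. of_nat ((2 * k) choose k) / 4 ^ k * H1 k)
              (2 - 2 * of_nat p + 4 * of_nat p ^ 2 * fermat_quotient p 2)) \<and>
         rat_cong p 1
           (\<Sum>k = 0..(p - 1) div 2. of_nat ((2 * k) choose k) / 4 ^ k * H2 k)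
           (- 4 * fermat_quotient p 2) \<and>
         rat_cong p 1
           (\<Sum>k = 1..(p - 1) div 2. of_nat ((2 * k) choose k) / (of_nat k * 4 ^ k) * H2 k)
           (bernoulli (p - 3) / 2)"
proof -
  interpret odd_prime_modulus p
    by unfold_locales (fact assms)+
  have "(\<Sum>k = 1..half. central k * (H2 k / of_nat k)) =
      (\<Sum>k = 1..half. of_nat ((2 * k) choose k) / (of_nat k * 4 ^ k) * H2 k)"
    by (simp add: central_def mult_ac)
  then show ?thesis
    using sum_central_harmonic_cong sum_central_harmonic2_cong sum_central_harmonic2_divide_cong
    unfolding central_def half_def by simp
qed

end
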